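(* Let $\mathcal{A}$ be a full replete monocoreflective subcategory of a category $\mathcal{B}$, with inclusion $\iota\colon\mathcal{A}\to\mathcal{B}$, right adjoint $R\colon\mathcal{B}\to\mathcal{A}$ of $\iota$, and counit $c$. Let $(\mathcal{T},\mathcal{F})$ be a pretorsion theory in $\mathcal{A}$ with class of trivial objects $\mathcal{Z}=\mathcal{T}\cap\mathcal{F}$, with associated torsion and torsionfree functors $t\colon\mathcal{A}\to\mathcal{T}$, $f\colon\mathcal{A}\to\mathcal{F}$ and short $\mathcal{Z}$-exact sequences $t(A)\xrightarrow{k_A}A\xrightarrow{r_A}f(A)$ in $\mathcal{A}$ for every $A\in\mathcal{A}$. Let $$\widetilde{\mathcal{T}}:=\mathcal{T},\qquad \widetilde{\mathcal{F}}:=\{B\in\mathcal{B}: R(B)\in\mathcal{F}\},$$ regarded as full replete subcategories of $\mathcal{B}$, and for every $B\in\mathcal{B}$ set $\varepsilon_B:=c_Bk_{R(B)}\colon tR(B)\to B$. Assume that the following conditions hold. (1) For every $B\in\mathcal{B}$, if there exists a morphism $B\to Z$ with $Z\in\mathcal{Z}$, then $B\in\mathcal{A}$. (2) For every $B\in\mathcal{B}$, there exist an object $F_B\in\mathcal{B}$, a morphism $\rho_B\colon B\to F_B$, and an isomorphism $\omega_B\colon R(F_B)\to fR(B)$ such that $\rho_B$ is a $\mathcal{Z}$-cokernel of $\varepsilon_B$ in $\mathcal{B}$ and $\omega_BR(\rho_B)=r_{R(B)}$. Then the pair $(\widetilde{\mathcal{T}},\widetilde{\mathcal{F}})$ is a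 pretorsion theory in $\mathcal{B}$ with class of trivial objects $\mathcal{Z}$.
   Context: $\mathcal{A}\subseteq\mathcal{B}$ is monocoreflective if the inclusion functor $\iota\colon\mathcal{A}\to\mathcal{B}$ has a right adjoint $R\colon\mathcal{B}\to\mathcal{A}$ and all counit components $c_B\colon\iota R(B)\to B$ ($B\in\mathcal{B}$) are monomorphisms. $\mathcal{A}$, $\mathcal{T}$ and $\mathcal{F}$ are identified with their essential images in $\mathcal{B}$, and the inclusion functors are omitted from the notation. Let $\mathcal{C}$ be a category and $\mathcal{Z}$ a class of objects of $\mathcal{C}$. A morphism is $\mathcal{Z}$-trivial if it factors through an object of $\mathcal{Z}$. A morphism $\varepsilon\colon X\to A$ is a $\mathcal{Z}$-kernel of $g\colon A\to A'$ if $g\varepsilon$ is $\mathcal{Z}$-trivial and, whenever $\lambda\colon Y\to A$ is such that $g\lambda$ is $\mathcal{Z}$-trivial, there is a unique $\lambda'\colon Y\to X$ with $\lambda=\varepsilon\lambda'$. $\mathcal{Z}$-cokernels are defined dually. A sequence $A\xrightarrow{g}B\xrightarrow{h}C$ is short $\mathcal{Z}$-exact if $g$ is a $\mathcal{Z}$-kernel of $h$ and $h$ is a $\mathcal{Z}$-cokernel of $g$. For full replete subcategories $\mathcal{T},\mathcal{F}$ of $\mathcal{C}$, the pair $(\mathcal{T},\mathcal{F})$ is a pretorsion theory in $\mathcal{C}$, with class of trivial objects $\mathcal{Z}:=\mathcal{T}\cap\mathcal{F}$, if (i) every morphism $T\to F$ with $T\in\mathcal{T}$ and $F\in\mathcal{F}$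 is $\mathcal{Z}$-trivial; (ii) for every object $X$ of $\mathcal{C}$ there is a short $\mathcal{Z}$-exact sequence $T_X\to X\to F_X$ with $T_X\in\mathcal{T}$ and $F_X\in\mathcal{F}$. The torsion and torsionfree functors $t$, $f$ are given by the choice of such sequences, $t(X)=T_X$ and $f(X)=F_X$. *)

theory Defs
  imports Main
begin

section \<open>Categories\<close>

text \<open>A category carries a class of objects inside a type of objects and a class of arrows inside
  a type of arrows. All other components are only meaningful on these classes;
  \<open>g \<cdot>\<^bsub>C\<^esub> f\<close> is the composite ``g after f''.\<close>

record ('o, 'm) cat =
  Obj :: "'o set"
  Arr :: "'m set"
  Dom :: "'m \<Rightarrow> 'o"
  Cod :: "'m \<Rightarrow> 'o"
  Id :: "'o \<Rightarrow> 'm"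
  Comp :: "'m \<Rightarrow> 'm \<Rightarrow> 'm"  (infixr "\<cdot>\<index>" 70)

definition Hom :: "('o, 'm) cat \<Rightarrow> 'o \<Rightarrow> 'o \<Rightarrow> 'm set" where
  "Hom C X Y = {f \<in> Arr C. Dom C f = X \<and> Cod C f = Y}"

locale category =
  fixes C :: "('o, 'm) cat" (structure)
  assumes dom_obj: "f \<in> Arr C \<Longrightarrow> Dom C f \<in> Obj C"
    and cod_obj: "f \<in> Arr C \<Longrightarrow> Cod C f \<in> Obj C"
    and id_hom: "X \<in> Obj C \<Longrightarrow> Id C X \<in> Hom C X X"
    and comp_hom: "f \<in> Hom C X Y \<Longrightarrow> g \<in> Hom C Y W \<Longrightarrow> g \<cdot> f \<in> Hom C X W"
    and comp_id_right: "f \<in> Hom C X Y \<Longrightarrow> f \<cdot> Id C X = f"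
    and comp_id_left: "f \<in> Hom C X Y \<Longrightarrow> Id C Y \<cdot> f = f"
    and comp_assoc: "f \<in> Hom C X Y \<Longrightarrow> g \<in> Hom C Y W \<Longrightarrow> h \<in> Hom C W V \<Longrightarrow>
      (h \<cdot> g) \<cdot> f = h \<cdot> (g \<cdot> f)"

definition monomorphism :: "('o, 'm) cat \<Rightarrow> 'm \<Rightarrow> bool" where
  "monomorphism C m \<longleftrightarrow> m \<in> Arr C \<and>
     (\<forall>Y \<in> Obj C. \<forall>g \<in> Hom C Y (Dom C m). \<forall>h \<in> Hom C Y (Dom C m).
        m \<cdot>\<^bsub>C\<^esub> g = m \<cdot>\<^bsub>C\<^esub> h \<longrightarrow> g = h)"

definition isomorphism :: "('o, 'm) cat \<Rightarrow> 'm \<Rightarrow> bool" where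
  "isomorphism C f \<longleftrightarrow> f \<in> Arr C \<and>
     (\<exists>g \<in> Hom C (Cod C f) (Dom C f).
        g \<cdot>\<^bsub>C\<^esub> f = Id C (Dom C f) \<and> f \<cdot>\<^bsub>C\<^esub> g = Id C (Cod C f))"

text \<open>A full subcategory is given by its class of objects.\<close>

definition full_subcat :: "('o, 'm) cat \<Rightarrow> 'o set \<Rightarrow> ('o, 'm) cat" where
  "full_subcat C S =
     C\<lparr>Obj := S, Arr := {f \<in> Arr C. Dom C f \<in> S \<and> Cod C f \<in> S}\<rparr>"

definition replete :: "('o, 'm) cat \<Rightarrow> 'o set \<Rightarrow> bool" where
  "replete C S \<longleftrightarrow> S \<subseteq> Obj C \<and>
     (\<forall>f. isomorphism C f \<longrightarrow> Dom C f \<in> S \<longrightarrow> Cod C f \<in> S)"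


section \<open>Functors and adjunctions\<close>

record ('o, 'm, 'p, 'n) func =
  FObj :: "'o \<Rightarrow> 'p"
  FArr :: "'m \<Rightarrow> 'n"

definition is_functor ::
  "('o, 'm) cat \<Rightarrow> ('p, 'n) cat \<Rightarrow> ('o, 'm, 'p, 'n) func \<Rightarrow> bool" where
  "is_functor C D F \<longleftrightarrow>
     (\<forall>X \<in> Obj C. FObj F X \<in> Obj D) \<and>
     (\<forall>X Y. \<forall>f \<in> Hom C X Y. FArr F f \<in> Hom D (FObj F X) (FObj F Y)) \<and>
     (\<forall>X \<in> Obj C. FArr F (Id C X) = Id D (FObj F X)) \<and>
     (\<forall>X Y W. \<forall>f \<in> Hom C X Y. \<forall>g \<in> Hom C Y W.
        FArr F (g \<cdot>\<^bsub>C\<^esub> f) = FArr F g \<cdot>\<^bsub>D\<^esub> FArr F f)"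

definition id_functor :: "('o, 'm, 'o, 'm) func" where
  "id_functor = \<lparr>FObj = (\<lambda>X. X), FArr = (\<lambda>f. f)\<rparr>"

text \<open>Functors do not store their source and target, so the inclusion of a full subcategory
  has the same underlying data as the identity functor.\<close>

abbreviation inclusion_functor :: "('o, 'm, 'o, 'm) func" where
  "inclusion_functor \<equiv> id_functor"

definition comp_functor ::
  "('p, 'n, 'q, 'k) func \<Rightarrow> ('o, 'm, 'p, 'n) func \<Rightarrow> ('o, 'm, 'q, 'k) func" where
  "comp_functor G F =
     \<lparr>FObj = (\<lambda>X. FObj G (FObj F X)), FArr = (\<lambda>f. FArr G (FArr F f))\<rparr>"

definition nat_trans ::
  "('o, 'm) cat \<Rightarrow> ('p, 'n) cat \<Rightarrow> ('o, 'm, 'p, 'n) func \<Rightarrow> ('o, 'm, 'p, 'n) func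
     \<Rightarrow> ('o \<Rightarrow> 'n) \<Rightarrow> bool" where
  "nat_trans C D F G \<tau> \<longleftrightarrow> is_functor C D F \<and> is_functor C D G \<and>
     (\<forall>X \<in> Obj C. \<tau> X \<in> Hom D (FObj F X) (FObj G X)) \<and>
     (\<forall>X Y. \<forall>f \<in> Hom C X Y. \<tau> Y \<cdot>\<^bsub>D\<^esub> FArr F f = FArr G f \<cdot>\<^bsub>D\<^esub> \<tau> X)"

definition adjunction ::
  "('o, 'm) cat \<Rightarrow> ('p, 'n) cat \<Rightarrow> ('o, 'm, 'p, 'n) func \<Rightarrow> ('p, 'n, 'o, 'm) func
     \<Rightarrow> ('o \<Rightarrow> 'm) \<Rightarrow> ('p \<Rightarrow> 'n) \<Rightarrow> bool" where
  "adjunction C D L G \<eta> c \<longleftrightarrow>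
     is_functor C D L \<and> is_functor D C G \<and>
     nat_trans C C id_functor (comp_functor G L) \<eta> \<and>
     nat_trans D D (comp_functor L G) id_functor c \<and>
     (\<forall>X \<in> Obj C. c (FObj L X) \<cdot>\<^bsub>D\<^esub> FArr L (\<eta> X) = Id D (FObj L X)) \<and>
     (\<forall>Y \<in> Obj D. FArr G (c Y) \<cdot>\<^bsub>C\<^esub> \<eta> (FObj G Y) = Id C (FObj G Y))"

definition right_adjoint_with_counit ::
  "('o, 'm) cat \<Rightarrow> ('p, 'n) cat \<Rightarrow> ('o, 'm, 'p, 'n) func \<Rightarrow> ('p, 'n, 'o, 'm) func
     \<Rightarrow> ('p \<Rightarrow> 'n) \<Rightarrow> bool" where
  "right_adjoint_with_counit C D L G c \<longleftrightarrow> (\<exists>\<eta>. adjunction C D L G \<eta> c)"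

text \<open>The full subcategory of \<open>B\<close> on \<open>S\<close> is monocoreflective, witnessed by the right adjoint \<open>R\<close>
  and the counit \<open>c\<close>.\<close>

definition monocoreflective_by ::
  "('o, 'm) cat \<Rightarrow> 'o set \<Rightarrow> ('o, 'm, 'o, 'm) func \<Rightarrow> ('o \<Rightarrow> 'm) \<Rightarrow> bool" where
  "monocoreflective_by B S R c \<longleftrightarrow>
     right_adjoint_with_counit (full_subcat B S) B inclusion_functor R c \<and>
     (\<forall>X \<in> Obj B. monomorphism B (c X))"


section \<open>Pretorsion theories\<close>

definition trivial_mor :: "('o, 'm) cat \<Rightarrow> 'o set \<Rightarrow> 'm \<Rightarrow> bool" where
  "trivial_mor C Z f \<longleftrightarrow> f \<in> Arr C \<and>
     (\<exists>W \<in> Z. \<exists>g \<in> Hom C (Dom C f) W. \<exists>h \<in> Hom C W (Cod C f). f = h \<cdot>\<^bsub>C\<^esub> g)"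

definition is_Zkernel :: "('o, 'm) cat \<Rightarrow> 'o set \<Rightarrow> 'm \<Rightarrow> 'm \<Rightarrow> bool" where
  "is_Zkernel C Z e g \<longleftrightarrow> e \<in> Arr C \<and> g \<in> Arr C \<and> Cod C e = Dom C g \<and>
     trivial_mor C Z (g \<cdot>\<^bsub>C\<^esub> e) \<and>
     (\<forall>Y \<in> Obj C. \<forall>l \<in> Hom C Y (Dom C g). trivial_mor C Z (g \<cdot>\<^bsub>C\<^esub> l) \<longrightarrow>
        (\<exists>!l'. l' \<in> Hom C Y (Dom C e) \<and> l = e \<cdot>\<^bsub>C\<^esub> l'))"

definition is_Zcokernel :: "('o, 'm) cat \<Rightarrow> 'o set \<Rightarrow> 'm \<Rightarrow> 'm \<Rightarrow> bool" where
  "is_Zcokernel C Z p g \<longleftrightarrow> p \<in> Arr C \<and> g \<in> Arr C \<and> Dom C p = Cod C g \<and>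
     trivial_mor C Z (p \<cdot>\<^bsub>C\<^esub> g) \<and>
     (\<forall>Y \<in> Obj C. \<forall>l \<in> Hom C (Cod C g) Y. trivial_mor C Z (l \<cdot>\<^bsub>C\<^esub> g) \<longrightarrow>
        (\<exists>!l'. l' \<in> Hom C (Cod C p) Y \<and> l = l' \<cdot>\<^bsub>C\<^esub> p))"

definition short_Zexact :: "('o, 'm) cat \<Rightarrow> 'o set \<Rightarrow> 'm \<Rightarrow> 'm \<Rightarrow> bool" where
  "short_Zexact C Z g h \<longleftrightarrow> is_Zkernel C Z g h \<and> is_Zcokernel C Z h g"

definition pretorsion_theory ::
  "('o, 'm) cat \<Rightarrow> 'o set \<Rightarrow> 'o set \<Rightarrow> 'o set \<Rightarrow> bool" where
  "pretorsion_theory C T F Z \<longleftrightarrow>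
     replete C T \<and> replete C F \<and> Z = T \<inter> F \<and>
     (\<forall>X \<in> T. \<forall>Y \<in> F. \<forall>g \<in> Hom C X Y. trivial_mor C Z g) \<and>
     (\<forall>X \<in> Obj C. \<exists>TX \<in> T. \<exists>FX \<in> F. \<exists>k \<in> Hom C TX X. \<exists>r \<in> Hom C X FX.
        short_Zexact C Z k r)"

text \<open>A choice of short \<open>Z\<close>-exact sequences \<open>t(X) \<rightarrow> X \<rightarrow> f(X)\<close> with maps \<open>k X\<close> and \<open>r X\<close>,
  together with the resulting functors \<open>t\<close> and \<open>f\<close>. Their action on arrows is the unique one making
  \<open>k\<close> and \<open>r\<close> natural; it exists for every choice of sequences, see \<open>torsion_functors_exist\<close>
  below.\<close>

definition torsion_functors ::
  "('o, 'm) cat \<Rightarrow> 'o set \<Rightarrow> 'o set \<Rightarrow> ('o, 'm, 'o, 'm) func \<Rightarrow> ('o, 'm, 'o, 'm) func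
     \<Rightarrow> ('o \<Rightarrow> 'm) \<Rightarrow> ('o \<Rightarrow> 'm) \<Rightarrow> bool" where
  "torsion_functors C T F t f k r \<longleftrightarrow>
     is_functor C (full_subcat C T) t \<and>
     is_functor C (full_subcat C F) f \<and>
     nat_trans C C (comp_functor inclusion_functor t) id_functor k \<and>
     nat_trans C C id_functor (comp_functor inclusion_functor f) r \<and>
     (\<forall>X \<in> Obj C. short_Zexact C (T \<inter> F) (k X) (r X))"

lemma torsion_functors_exist:
  fixes C :: "('o, 'm) cat" (structure)
  assumes C: "category C" and pt: "pretorsion_theory C T F Z"
    and t0: "\<forall>X \<in> Obj C. t0 X \<in> T" and f0: "\<forall>X \<in> Obj C. f0 X \<in> F"
    and k: "\<forall>X \<in> Obj C. k X \<in> Hom C (t0 X) X"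
    and r: "\<forall>X \<in> Obj C. r X \<in> Hom C X (f0 X)"
    and ex: "\<forall>X \<in> Obj C. short_Zexact C Z (k X) (r X)"
  shows "\<exists>t f. FObj t = t0 \<and> FObj f = f0 \<and> torsion_functors C T F t f k r"
proof -
  interpret category C by (rule C)
  have Z: "Z = T \<inter> F" and triv: "\<And>X Y g. X \<in> T \<Longrightarrow> Y \<in> F \<Longrightarrow> g \<in> Hom C X Y \<Longrightarrow> trivial_mor C Z g"
    and TO: "T \<subseteq> Obj C" and FO: "F \<subseteq> Obj C"
    using pt by (auto simp: pretorsion_theory_def replete_def)
  have ob: "X \<in> Obj C" "Y \<in> Obj C" if "g \<in> Hom C X Y" for g X Y
    using that dom_obj cod_obj by (auto simp: Hom_def)
  have sq: "trivial_mor C Z (r Y \<cdot> (g \<cdot> k X))" "trivial_mor C Z ((r Y \<cdot> g) \<cdot> k X)"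
    if g: "g \<in> Hom C X Y" for g X Y
  proof -
    have X: "X \<in> Obj C" and Y: "Y \<in> Obj C" using ob[OF g] by auto
    have h: "r Y \<cdot> (g \<cdot> k X) \<in> Hom C (t0 X) (f0 Y)"
      using k r X Y g comp_hom by blast
    show "trivial_mor C Z (r Y \<cdot> (g \<cdot> k X))" using triv[OF _ _ h] t0 f0 X Y by blast
    thus "trivial_mor C Z ((r Y \<cdot> g) \<cdot> k X)"
      using comp_assoc k r X Y g by metis
  qed
  have lk: "\<exists>!l'. l' \<in> Hom C W (t0 X) \<and> l = k X \<cdot> l'"
    if "X \<in> Obj C" "l \<in> Hom C W X" "trivial_mor C Z (r X \<cdot> l)" for l W X
  proof -
    have "Dom C (r X) = X" "Dom C (k X) = t0 X" using k r that(1) by (auto simp: Hom_def)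
    moreover have "is_Zkernel C Z (k X) (r X)" using ex that(1) by (simp add: short_Zexact_def)
    ultimately show ?thesis using that(2,3) ob(1)[OF that(2)] unfolding is_Zkernel_def by metis
  qed
  have lr: "\<exists>!l'. l' \<in> Hom C (f0 X) W \<and> l = l' \<cdot> r X"
    if "X \<in> Obj C" "l \<in> Hom C X W" "trivial_mor C Z (l \<cdot> k X)" for l W X
  proof -
    have "Cod C (k X) = X" "Cod C (r X) = f0 X" using k r that(1) by (auto simp: Hom_def)
    moreover have "is_Zcokernel C Z (r X) (k X)" using ex that(1) by (simp add: short_Zexact_def)
    ultimately show ?thesis using that(2,3) ob(2)[OF that(2)] unfolding is_Zcokernel_def by metis
  qed
  define ta where "ta g = (THE h. h \<in> Hom C (t0 (Dom C g)) (t0 (Cod C g)) \<and>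
      g \<cdot> k (Dom C g) = k (Cod C g) \<cdot> h)" for g
  define fa where "fa g = (THE h. h \<in> Hom C (f0 (Dom C g)) (f0 (Cod C g)) \<and>
      r (Cod C g) \<cdot> g = h \<cdot> r (Dom C g))" for g
  have tu: "\<exists>!h. h \<in> Hom C (t0 X) (t0 Y) \<and> g \<cdot> k X = k Y \<cdot> h"
    if g: "g \<in> Hom C X Y" for g X Y
    using lk[of Y "g \<cdot> k X" "t0 X"] sq(1)[OF g] comp_hom k ob[OF g] g by blast
  have fu: "\<exists>!h. h \<in> Hom C (f0 X) (f0 Y) \<and> r Y \<cdot> g = h \<cdot> r X"
    if g: "g \<in> Hom C X Y" for g X Y
    using lr[of X "r Y \<cdot> g" "f0 Y"] sq(2)[OF g] comp_hom r ob[OF g] g by blast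
  have ta: "ta g \<in> Hom C (t0 X) (t0 Y) \<and> g \<cdot> k X = k Y \<cdot> ta g" if g: "g \<in> Hom C X Y" for g X Y
    using theI'[OF tu[OF g]] g unfolding ta_def by (simp add: Hom_def)
  have fa: "fa g \<in> Hom C (f0 X) (f0 Y) \<and> r Y \<cdot> g = fa g \<cdot> r X" if g: "g \<in> Hom C X Y" for g X Y
    using theI'[OF fu[OF g]] g unfolding fa_def by (simp add: Hom_def)
  have ta_eq: "ta g = h" if "g \<in> Hom C X Y" "h \<in> Hom C (t0 X) (t0 Y)" "g \<cdot> k X = k Y \<cdot> h" for g h X Y
    using ta[OF that(1)] tu[OF that(1)] that by blast
  have fa_eq: "fa g = h" if "g \<in> Hom C X Y" "h \<in> Hom C (f0 X) (f0 Y)" "r Y \<cdot> g = h \<cdot> r X" for g h X Y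
    using fa[OF that(1)] fu[OF that(1)] that by blast
  have t_id: "ta (Id C X) = Id C (t0 X)" if "X \<in> Obj C" for X
    using ta_eq[OF id_hom[OF that] id_hom] comp_id_left comp_id_right k t0 TO that
    by (metis subsetD)
  have f_id: "fa (Id C X) = Id C (f0 X)" if "X \<in> Obj C" for X
    using fa_eq[OF id_hom[OF that] id_hom] comp_id_left comp_id_right r f0 FO that
    by (metis subsetD)
  have t_comp: "ta (g \<cdot> h) = ta g \<cdot> ta h" if h: "h \<in> Hom C X Y" and g: "g \<in> Hom C Y W" for g h X Y W
  proof (rule ta_eq[OF comp_hom[OF h g]])
    note kk = k[rule_format, OF ob(1)[OF h]] k[rule_format, OF ob(1)[OF g]]
      k[rule_format, OF ob(2)[OF g]]
    note th = ta[OF h] and tg = ta[OF g]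
    show "ta g \<cdot> ta h \<in> Hom C (t0 X) (t0 W)" using th tg comp_hom by blast
    have "(g \<cdot> h) \<cdot> k X = g \<cdot> (k Y \<cdot> ta h)" using comp_assoc[OF kk(1) h g] th by simp
    also have "\<dots> = (k W \<cdot> ta g) \<cdot> ta h" using comp_assoc[OF _ kk(2) g] th tg by metis
    also have "\<dots> = k W \<cdot> (ta g \<cdot> ta h)" using comp_assoc[OF _ _ kk(3)] th tg by metis
    finally show "(g \<cdot> h) \<cdot> k X = k W \<cdot> (ta g \<cdot> ta h)" .
  qed
  have f_comp: "fa (g \<cdot> h) = fa g \<cdot> fa h" if h: "h \<in> Hom C X Y" and g: "g \<in> Hom C Y W" for g h X Y W
  proof (rule fa_eq[OF comp_hom[OF h g]])
    note rr = r[rule_format, OF ob(1)[OF h]] r[rule_format, OF ob(1)[OF g]]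
      r[rule_format, OF ob(2)[OF g]]
    note th = fa[OF h] and tg = fa[OF g]
    show "fa g \<cdot> fa h \<in> Hom C (f0 X) (f0 W)" using th tg comp_hom by blast
    have "r W \<cdot> (g \<cdot> h) = (fa g \<cdot> r Y) \<cdot> h" using comp_assoc[OF h g rr(3)] tg by simp
    also have "\<dots> = fa g \<cdot> (fa h \<cdot> r X)" using comp_assoc[OF h rr(2)] th tg by metis
    also have "\<dots> = (fa g \<cdot> fa h) \<cdot> r X" using comp_assoc[OF rr(1)] th tg by metis
    finally show "r W \<cdot> (g \<cdot> h) = (fa g \<cdot> fa h) \<cdot> r X" .
  qed
  let ?t = "\<lparr>FObj = t0, FArr = ta\<rparr>" and ?f = "\<lparr>FObj = f0, FArr = fa\<rparr>"
  have HS: "Hom (full_subcat C S) X Y = (if X \<in> S \<and> Y \<in> S then Hom C X Y else {})" for S X Y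
    by (auto simp: Hom_def full_subcat_def)
  have ft: "is_functor C (full_subcat C T) ?t" "is_functor C C (comp_functor id_functor ?t)"
    unfolding is_functor_def HS using ta t_id t_comp t0 TO ob
    by (auto simp: comp_functor_def id_functor_def full_subcat_def)
  have ff: "is_functor C (full_subcat C F) ?f" "is_functor C C (comp_functor id_functor ?f)"
    unfolding is_functor_def HS using fa f_id f_comp f0 FO ob
    by (auto simp: comp_functor_def id_functor_def full_subcat_def)
  have fi: "is_functor C C id_functor" by (simp add: is_functor_def id_functor_def)
  have "nat_trans C C (comp_functor id_functor ?t) id_functor k"
    using ft fi k ta by (auto simp: nat_trans_def comp_functor_def id_functor_def)
  moreover have "nat_trans C C id_functor (comp_functor id_functor ?f) r"
    using ff fi r fa by (auto simp: nat_trans_def comp_functor_def id_functor_def)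
  ultimately have "torsion_functors C T F ?t ?f k r"
    using ft ff ex Z by (simp add: torsion_functors_def)
  thus ?thesis by (intro exI[of _ ?t] exI[of _ ?f]) simp
qed

end

theory Submission
  imports Defs
begin

text \<open>By adjunction, a morphism from an object of \<open>\<A>\<close> to \<open>X\<close> is the same as a morphism to
  \<open>R X\<close>; and for \<open>X\<close> in \<open>\<A>\<close> the counit component \<open>c\<^sub>X\<close> is a split epimorphism by the triangle
  identity, hence invertible because it is monic. The first fact turns the
  \<open>\<Z>\<close>-triviality of morphisms from \<open>\<T>\<close> to \<open>\<F>\<close> into the same statement for the extended pair; the
  second shows that the extended torsionfree class meets \<open>\<A>\<close> in \<open>\<F>\<close>. For the exact sequences one
  has to see that \<open>\<epsilon>\<^sub>X\<close> is a \<open>\<Z>\<close>-kernel of \<open>\<rho>\<^sub>X\<close>: if \<open>\<rho>\<^sub>X l\<close> is trivial, condition (1) puts the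
  domain of \<open>l\<close> into \<open>\<A>\<close>, so \<open>l\<close> and the trivial factorisation both lift along the counit, and
  \<open>\<omega>\<^sub>X\<close> identifies the lifted problem with the \<open>\<Z>\<close>-kernel property of \<open>k\<close> at \<open>R X\<close>.\<close>

section \<open>Full subcategories, isomorphisms and repleteness\<close>

lemma full_subcat_simps [simp]:
  "Obj (full_subcat C S) = S"
  "Dom (full_subcat C S) = Dom C"
  "Cod (full_subcat C S) = Cod C"
  "Id (full_subcat C S) = Id C"
  "Comp (full_subcat C S) = Comp C"
  by (simp_all add: full_subcat_def)

lemma Hom_full_subcat:
  "Hom (full_subcat C S) X Y = (if X \<in> S \<and> Y \<in> S then Hom C X Y else {})"
  by (auto simp: Hom_def full_subcat_def)

lemma HomD: "g \<in> Hom C X Y \<Longrightarrow> g \<in> Arr C \<and> Dom C g = X \<and> Cod C g = Y"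
  by (simp add: Hom_def)

lemma trivial_mor_iff:
  assumes "g \<in> Hom C X Y"
  shows "trivial_mor C Z g \<longleftrightarrow> (\<exists>W\<in>Z. \<exists>u\<in>Hom C X W. \<exists>v\<in>Hom C W Y. g = v \<cdot>\<^bsub>C\<^esub> u)"
  using HomD[OF assms] by (simp add: trivial_mor_def)

text \<open>Fullness puts both legs of a factorisation into the subcategory once the intermediate
  object lies in \<open>S\<close>, which the inclusion of \<open>Z\<close> in \<open>S\<close>
  guarantees.\<close>

lemma trivial_mor_full_subcat_iff:
  assumes "g \<in> Hom C X Y" "X \<in> S" "Y \<in> S" "Z \<subseteq> S"
  shows "trivial_mor (full_subcat C S) Z g \<longleftrightarrow> trivial_mor C Z g"
proof -
  have "g \<in> Hom (full_subcat C S) X Y" using assms by (simp add: Hom_full_subcat)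
  from trivial_mor_iff[OF this] trivial_mor_iff[OF assms(1)] show ?thesis
    using assms(2-4) by (auto simp: Hom_full_subcat subset_iff)
qed

lemma isomorphism_iff:
  assumes "g \<in> Hom C X Y"
  shows "isomorphism C g \<longleftrightarrow> (\<exists>h\<in>Hom C Y X. h \<cdot>\<^bsub>C\<^esub> g = Id C X \<and> g \<cdot>\<^bsub>C\<^esub> h = Id C Y)"
  using HomD[OF assms] by (simp add: isomorphism_def)

lemma isomorphism_full_subcat_iff:
  assumes "g \<in> Hom C X Y" "X \<in> S" "Y \<in> S"
  shows "isomorphism (full_subcat C S) g \<longleftrightarrow> isomorphism C g"
proof -
  have "g \<in> Hom (full_subcat C S) X Y" using assms by (simp add: Hom_full_subcat)
  from isomorphism_iff[OF this] isomorphism_iff[OF assms(1)] show ?thesis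
    using assms(2,3) by (simp add: Hom_full_subcat)
qed

lemma isomorphism_inverse:
  assumes "g \<in> Hom C X Y" "isomorphism C g"
  obtains h where "h \<in> Hom C Y X" "isomorphism C h"
    "h \<cdot>\<^bsub>C\<^esub> g = Id C X" "g \<cdot>\<^bsub>C\<^esub> h = Id C Y"
proof -
  obtain h where h: "h \<in> Hom C Y X" "h \<cdot>\<^bsub>C\<^esub> g = Id C X" "g \<cdot>\<^bsub>C\<^esub> h = Id C Y"
    using assms(2) isomorphism_iff[OF assms(1)] by blast
  then have "isomorphism C h" using isomorphism_iff[OF h(1)] assms(1) by blast
  with h show thesis using that by blast
qed

lemma repleteD:
  assumes "replete C S" "g \<in> Hom C X Y" "isomorphism C g" "X \<in> S"
  shows "Y \<in> S"
  using assms HomD[OF assms(2)] by (auto simp: replete_def)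

lemma replete_iso_iff:
  assumes "replete C S" "g \<in> Hom C X Y" "isomorphism C g"
  shows "X \<in> S \<longleftrightarrow> Y \<in> S"
proof
  obtain h where h: "h \<in> Hom C Y X" "isomorphism C h"
    using isomorphism_inverse[OF assms(2,3)] .
  show "Y \<in> S \<Longrightarrow> X \<in> S" using repleteD[OF assms(1) h] .
qed (rule repleteD[OF assms])

text \<open>Repleteness of \<open>S\<close> first brings the codomain into \<open>S\<close>;
  fullness then makes the isomorphism and its inverse arrows of the subcategory, where repleteness
  of \<open>T\<close> applies.\<close>

lemma replete_full_subcat_trans:
  assumes S: "replete C S" and T: "replete (full_subcat C S) T"
  shows "replete C T"
proof -
  have TS: "T \<subseteq> S" using T by (simp add: replete_def)
  have "Cod C g \<in> T" if g: "isomorphism C g" and X: "Dom C g \<in> T" for g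
  proof -
    have h: "g \<in> Hom C (Dom C g) (Cod C g)" using g by (simp add: isomorphism_def Hom_def)
    have Y: "Cod C g \<in> S" using repleteD[OF S h g] X TS by blast
    have "g \<in> Hom (full_subcat C S) (Dom C g) (Cod C g)"
      using h X Y TS by (auto simp: Hom_full_subcat)
    moreover have "isomorphism (full_subcat C S) g"
      using g isomorphism_full_subcat_iff[OF h _ Y] X TS by blast
    ultimately show ?thesis using repleteD[OF T] X by blast
  qed
  then show ?thesis using S TS by (auto simp: replete_def)
qed

section \<open>Functors and trivial morphisms\<close>

lemma is_functorD:
  assumes "is_functor C D G"
  shows "X \<in> Obj C \<Longrightarrow> FObj G X \<in> Obj D"
    and "g \<in> Hom C X Y \<Longrightarrow> FArr G g \<in> Hom D (FObj G X) (FObj G Y)"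
    and "X \<in> Obj C \<Longrightarrow> FArr G (Id C X) = Id D (FObj G X)"
    and "g \<in> Hom C X Y \<Longrightarrow> h \<in> Hom C Y W \<Longrightarrow>
      FArr G (h \<cdot>\<^bsub>C\<^esub> g) = FArr G h \<cdot>\<^bsub>D\<^esub> FArr G g"
  using assms by (auto simp: is_functor_def)

lemma (in category) Hom_obj:
  assumes "g \<in> Hom C X Y"
  shows "X \<in> Obj C" "Y \<in> Obj C"
  using HomD[OF assms] dom_obj cod_obj by auto

lemma (in category) functor_isomorphism:
  assumes "is_functor C D G" "g \<in> Hom C X Y" "isomorphism C g"
  shows "isomorphism D (FArr G g)"
proof -
  note G = is_functorD[OF assms(1)]
  obtain h where h: "h \<in> Hom C Y X" "h \<cdot> g = Id C X" "g \<cdot> h = Id C Y"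
    using isomorphism_inverse[OF assms(2,3)] .
  have "FArr G h \<cdot>\<^bsub>D\<^esub> FArr G g = Id D (FObj G X)" "FArr G g \<cdot>\<^bsub>D\<^esub> FArr G h = Id D (FObj G Y)"
    using G(3,4) h assms(2) Hom_obj[OF assms(2)] by metis+
  then show ?thesis using isomorphism_iff[OF G(2)[OF assms(2)]] G(2)[OF h(1)] by blast
qed

lemma (in category) trivial_mor_comp_left:
  assumes "g \<in> Hom C X Y" "h \<in> Hom C Y W" "trivial_mor C Z g"
  shows "trivial_mor C Z (h \<cdot> g)"
proof -
  obtain V u v where "V \<in> Z" "u \<in> Hom C X V" "v \<in> Hom C V Y" "g = v \<cdot> u"
    using assms(3) trivial_mor_iff[OF assms(1)] by blast
  moreover from this have "h \<cdot> g = (h \<cdot> v) \<cdot> u" using comp_assoc assms(2) by metis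
  moreover have "h \<cdot> v \<in> Hom C V W" using \<open>v \<in> Hom C V Y\<close> assms(2) by (rule comp_hom)
  ultimately show ?thesis using trivial_mor_iff[OF comp_hom[OF assms(1,2)]] by blast
qed

section \<open>Monocoreflective subcategories and lifting along the counit\<close>

locale monocoreflection = category C for C :: "('o, 'm) cat" (structure) +
  fixes S :: "'o set" and R :: "('o, 'm, 'o, 'm) func" and c :: "'o \<Rightarrow> 'm"
  assumes coreflective: "monocoreflective_by C S R c"
    and replete: "replete C S"
begin

lemma S_obj: "X \<in> S \<Longrightarrow> X \<in> Obj C"
  using replete by (auto simp: replete_def)

lemma R_functor: "is_functor C (full_subcat C S) R"
  using coreflective
  by (auto simp: monocoreflective_by_def right_adjoint_with_counit_def adjunction_def)

lemma R_obj: "X \<in> Obj C \<Longrightarrow> FObj R X \<in> S"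
  using is_functorD(1)[OF R_functor] by simp

lemma R_hom: "g \<in> Hom C X Y \<Longrightarrow> FArr R g \<in> Hom C (FObj R X) (FObj R Y)"
  using is_functorD(2)[OF R_functor, of g X Y] by (simp add: Hom_full_subcat split: if_splits)

lemma R_isomorphism:
  assumes "g \<in> Hom C X Y" "isomorphism C g"
  shows "isomorphism C (FArr R g)"
  using functor_isomorphism[OF R_functor assms]
    isomorphism_full_subcat_iff[OF R_hom[OF assms(1)] R_obj R_obj] Hom_obj[OF assms(1)] by blast

lemma counit_hom: "X \<in> Obj C \<Longrightarrow> c X \<in> Hom C (FObj R X) X"
  using coreflective
  by (auto simp: monocoreflective_by_def right_adjoint_with_counit_def adjunction_def
      nat_trans_def comp_functor_def id_functor_def)

lemma counit_natural: "g \<in> Hom C X Y \<Longrightarrow> c Y \<cdot> FArr R g = g \<cdot> c X"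
  using coreflective
  by (auto simp: monocoreflective_by_def right_adjoint_with_counit_def adjunction_def
      nat_trans_def comp_functor_def id_functor_def)

text \<open>The section is the unit at \<open>X\<close>: a triangle identity takes this form because
  the inclusion acts as the identity on arrows.\<close>

lemma counit_section:
  assumes "X \<in> S"
  obtains s where "s \<in> Hom C X (FObj R X)" "c X \<cdot> s = Id C X"
proof -
  obtain \<eta> where "adjunction (full_subcat C S) C id_functor R \<eta> c"
    using coreflective
    by (auto simp: monocoreflective_by_def right_adjoint_with_counit_def)
  then have "\<eta> X \<in> Hom (full_subcat C S) X (FObj R X)" "c X \<cdot> \<eta> X = Id C X"
    using assms by (auto simp: adjunction_def nat_trans_def comp_functor_def id_functor_def)
  then show thesis by (intro that[of "\<eta> X"]) (auto simp: Hom_full_subcat split: if_splits)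
qed

lemma counit_cancel:
  assumes "X \<in> Obj C" "g \<in> Hom C Y (FObj R X)" "h \<in> Hom C Y (FObj R X)" "c X \<cdot> g = c X \<cdot> h"
  shows "g = h"
proof -
  have "monomorphism C (c X)" using coreflective assms(1) by (simp add: monocoreflective_by_def)
  then show ?thesis
    using assms HomD[OF counit_hom[OF assms(1)]] Hom_obj(1)[OF assms(2)]
    by (auto simp: monomorphism_def)
qed

lemma counit_isomorphism:
  assumes X: "X \<in> S"
  shows "isomorphism C (c X)"
proof -
  note cX = counit_hom[OF S_obj[OF X]]
  obtain s where s: "s \<in> Hom C X (FObj R X)" "c X \<cdot> s = Id C X" using counit_section X by blast
  \<comment> \<open>Both sides equal \<open>c X\<close>, so cancelling the monomorphism
    \<open>c X\<close> makes its right inverse \<open>s\<close> two-sided.\<close>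
  have "c X \<cdot> (s \<cdot> c X) = c X \<cdot> Id C (FObj R X)"
    using comp_assoc[OF cX s(1) cX] s(2) comp_id_left[OF cX] comp_id_right[OF cX] by simp
  then have "s \<cdot> c X = Id C (FObj R X)"
    using counit_cancel[OF S_obj[OF X]] comp_hom[OF cX s(1)] id_hom Hom_obj(1)[OF cX] by blast
  then show ?thesis using isomorphism_iff[OF cX] s by blast
qed

text \<open>The lift is the adjoint transpose \<open>FArr R g \<cdot> s\<close>, with
  \<open>s\<close> the section of \<open>c X\<close>; naturality of the counit verifies it. Its
  uniqueness is \<open>counit_cancel\<close>.\<close>

lemma counit_lift:
  assumes g: "g \<in> Hom C X Y" and X: "X \<in> S"
  obtains g' where "g' \<in> Hom C X (FObj R Y)" "g = c Y \<cdot> g'"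
proof -
  note Y = Hom_obj(2)[OF g]
  note cX = counit_hom[OF S_obj[OF X]] and cY = counit_hom[OF Y]
  obtain s where s: "s \<in> Hom C X (FObj R X)" "c X \<cdot> s = Id C X" using counit_section X by blast
  have "c Y \<cdot> (FArr R g \<cdot> s) = (g \<cdot> c X) \<cdot> s"
    using comp_assoc[OF s(1) R_hom[OF g] cY] counit_natural[OF g] by simp
  also have "\<dots> = g" using comp_assoc[OF s(1) cX g] s(2) comp_id_right[OF g] by simp
  finally show thesis using that comp_hom[OF s(1) R_hom[OF g]] by simp
qed

text \<open>The intermediate object lies in \<open>S\<close>, so the second leg of the factorisation
  lifts along the counit; cancelling the monic \<open>c X\<close> then factors \<open>g\<close>
  through the same object.\<close>

lemma trivial_mor_counitD:
  assumes X: "X \<in> Obj C" and g: "g \<in> Hom C Y (FObj R X)" and Z: "Z \<subseteq> S"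
    and triv: "trivial_mor C Z (c X \<cdot> g)"
  shows "trivial_mor C Z g"
proof -
  note cX = counit_hom[OF X]
  obtain W u v where W: "W \<in> Z" and u: "u \<in> Hom C Y W" and v: "v \<in> Hom C W X"
    and eq: "c X \<cdot> g = v \<cdot> u"
    using triv trivial_mor_iff[OF comp_hom[OF g cX]] by blast
  obtain v' where v': "v' \<in> Hom C W (FObj R X)" "v = c X \<cdot> v'"
    using counit_lift[OF v] W Z by blast
  have "c X \<cdot> g = c X \<cdot> (v' \<cdot> u)" using eq v'(2) comp_assoc[OF u v'(1) cX] by simp
  then have "g = v' \<cdot> u" using counit_cancel[OF X g comp_hom[OF u v'(1)]] by simp
  then show ?thesis using trivial_mor_iff[OF g] W u v'(1) by blast
qed

text \<open>\<open>R\<close> preserves isomorphisms, and \<open>F\<close> is replete in the whole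
  category because \<open>S\<close> is.\<close>

lemma replete_R_preimage:
  assumes "replete (full_subcat C S) F"
  shows "replete C {X \<in> Obj C. FObj R X \<in> F}"
proof -
  have "Cod C g \<in> Obj C \<and> FObj R (Cod C g) \<in> F"
    if g: "isomorphism C g" and F: "FObj R (Dom C g) \<in> F" for g
  proof -
    have h: "g \<in> Hom C (Dom C g) (Cod C g)" using g by (simp add: isomorphism_def Hom_def)
    show ?thesis
      using repleteD[OF replete_full_subcat_trans[OF replete assms] R_hom[OF h] R_isomorphism[OF h g] F]
        Hom_obj[OF h] by blast
  qed
  then show ?thesis by (auto simp: replete_def)
qed

lemma R_in_iff:
  assumes "replete (full_subcat C S) F" "X \<in> S"
  shows "FObj R X \<in> F \<longleftrightarrow> X \<in> F"
  using replete_iso_iff[OF replete_full_subcat_trans[OF replete assms(1)]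
      counit_hom[OF S_obj[OF assms(2)]] counit_isomorphism[OF assms(2)]] .

text \<open>Carries kernels from the subcategory to the ambient category. The hypothesis
  \<open>dom\<close> encodes condition (1), and \<open>\<omega>\<close> transports triviality from
  \<open>FArr R \<rho>\<close> to \<open>r\<close>.\<close>

lemma is_Zkernel_counit_comp:
  assumes Z: "Z \<subseteq> S"
    and dom: "\<And>Y W. W \<in> Z \<Longrightarrow> Hom C Y W \<noteq> {} \<Longrightarrow> Y \<in> S"
    and \<rho>: "\<rho> \<in> Hom C X X'"
    and k: "k \<in> Hom C K (FObj R X)" and K: "K \<in> S"
    and r: "r \<in> Hom C (FObj R X) F"
    and ker: "is_Zkernel (full_subcat C S) Z k r"
    and \<omega>: "\<omega> \<in> Hom C (FObj R X') F" "\<omega> \<cdot> FArr R \<rho> = r"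
    and triv: "trivial_mor C Z (\<rho> \<cdot> (c X \<cdot> k))"
  shows "is_Zkernel C Z (c X \<cdot> k) \<rho>"
proof -
  note X = Hom_obj[OF \<rho>] and R\<rho> = R_hom[OF \<rho>]
  note cX = counit_hom[OF X(1)] and cX' = counit_hom[OF X(2)]
  note ck = comp_hom[OF k cX]
  \<comment> \<open>As an arrow of the subcategory, \<open>r\<close> has its codomain in
    \<open>S\<close>.\<close>
  have F: "F \<in> S" using ker HomD[OF r] by (auto simp: is_Zkernel_def full_subcat_def)
  have "\<exists>!m. m \<in> Hom C Y K \<and> l = (c X \<cdot> k) \<cdot> m"
    if l: "l \<in> Hom C Y X" and lt: "trivial_mor C Z (\<rho> \<cdot> l)" for Y l
  proof -
    have Y: "Y \<in> S" using lt trivial_mor_iff[OF comp_hom[OF l \<rho>]] dom by blast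
    obtain l' where l': "l' \<in> Hom C Y (FObj R X)" "l = c X \<cdot> l'" using counit_lift[OF l Y] .
    \<comment> \<open>Naturality replaces \<open>\<rho>\<close> by \<open>FArr R \<rho>\<close>
      behind a counit component, which \<open>trivial_mor_counitD\<close> strips off.\<close>
    have "\<rho> \<cdot> l = c X' \<cdot> (FArr R \<rho> \<cdot> l')"
      using comp_assoc[OF l'(1) cX \<rho>] comp_assoc[OF l'(1) R\<rho> cX'] counit_natural[OF \<rho>] l'(2)
      by simp
    then have "trivial_mor C Z (FArr R \<rho> \<cdot> l')"
      using trivial_mor_counitD[OF X(2) comp_hom[OF l'(1) R\<rho>] Z] lt by simp
    then have "trivial_mor C Z (r \<cdot> l')"
      using trivial_mor_comp_left[OF comp_hom[OF l'(1) R\<rho>] \<omega>(1)] comp_assoc[OF l'(1) R\<rho> \<omega>(1)] \<omega>(2)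
      by simp
    then have "trivial_mor (full_subcat C S) Z (r \<cdot> l')"
      using trivial_mor_full_subcat_iff[OF comp_hom[OF l'(1) r] Y F Z] by simp
    then have ex: "\<exists>!m. m \<in> Hom C Y K \<and> l' = k \<cdot> m"
      using ker HomD[OF r] HomD[OF k] l'(1) Y K R_obj[OF X(1)]
      by (simp add: is_Zkernel_def Hom_full_subcat)
    \<comment> \<open>Since \<open>c X\<close> is monic, \<open>l\<close> and \<open>l'\<close> have
      the same factorising arrows \<open>m\<close>, so existence and uniqueness transfer
      together.\<close>
    have "l = (c X \<cdot> k) \<cdot> m \<longleftrightarrow> l' = k \<cdot> m" if m: "m \<in> Hom C Y K" for m
      using comp_assoc[OF m k cX] l'(2) counit_cancel[OF X(1) l'(1) comp_hom[OF m k]] by auto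
    with ex show ?thesis by (simp cong: conj_cong)
  qed
  then show ?thesis using HomD[OF ck] HomD[OF \<rho>] triv by (simp add: is_Zkernel_def)
qed

end

section \<open>The extended pretorsion theory\<close>

theorem theorem5p6:
  fixes B :: "('o, 'm) cat"
    and ObA T F Z Ttilde Ftilde :: "'o set"
    and A :: "('o, 'm) cat"
    and R t f :: "('o, 'm, 'o, 'm) func"
    and c k r \<epsilon> :: "'o \<Rightarrow> 'm"
  defines "A \<equiv> full_subcat B ObA"
    and "Ttilde \<equiv> T"
    and "Ftilde \<equiv> {X \<in> Obj B. FObj R X \<in> F}"
    and "\<epsilon> \<equiv> (\<lambda>X. c X \<cdot>\<^bsub>B\<^esub> k (FObj R X))"
  assumes "category B"
    and "replete B ObA"
    and "monocoreflective_by B ObA R c"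
    and "pretorsion_theory A T F Z"
    and "torsion_functors A T F t f k r"
    and cond1: "\<forall>X \<in> Obj B. (\<exists>W \<in> Z. Hom B X W \<noteq> {}) \<longrightarrow> X \<in> Obj A"
    and cond2: "\<forall>X \<in> Obj B. \<exists>FX \<in> Obj B. \<exists>\<rho> \<in> Hom B X FX.
      \<exists>\<omega> \<in> Hom A (FObj R FX) (FObj f (FObj R X)).
        isomorphism A \<omega> \<and> is_Zcokernel B Z \<rho> (\<epsilon> X) \<and>
        \<omega> \<cdot>\<^bsub>A\<^esub> FArr R \<rho> = r (FObj R X)"
  shows "pretorsion_theory B Ttilde Ftilde Z"
proof -
  interpret monocoreflection B ObA R c
    using assms(5-7) by (intro monocoreflection.intro monocoreflection_axioms.intro)
  have ft: "replete A T" "replete A F" and Z: "Z = T \<inter> F"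
    and triv: "\<And>X Y g. X \<in> T \<Longrightarrow> Y \<in> F \<Longrightarrow> g \<in> Hom A X Y \<Longrightarrow> trivial_mor A Z g"
    using assms(8) by (auto simp: pretorsion_theory_def)
  have sub: "T \<subseteq> ObA" "F \<subseteq> ObA" using ft by (simp_all add: replete_def A_def)
  then have ZA: "Z \<subseteq> ObA" using Z by blast
  have TF: "FObj t X \<in> T" "FObj f X \<in> F" "k X \<in> Hom A (FObj t X) X" "r X \<in> Hom A X (FObj f X)"
    "is_Zkernel A Z (k X) (r X)" if "X \<in> ObA" for X
    using assms(9) that Z
    by (auto simp: torsion_functors_def is_functor_def nat_trans_def A_def comp_functor_def
        id_functor_def short_Zexact_def)
  have HA: "Hom A X Y \<subseteq> Hom B X Y" for X Y by (simp add: A_def Hom_full_subcat)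
  have "replete B Ttilde"
    using replete_full_subcat_trans[OF replete] ft(1) by (simp add: A_def Ttilde_def)
  moreover have "replete B Ftilde"
    using replete_R_preimage ft(2) by (simp add: A_def Ftilde_def)
  \<comment> \<open>Objects of \<open>T\<close> lie in \<open>ObA\<close>, where
    \<open>R_in_iff\<close> makes membership in \<open>Ftilde\<close> the same as membership in
    \<open>F\<close>.\<close>
  moreover have "Z = Ttilde \<inter> Ftilde"
    using R_in_iff ft(2) sub S_obj by (auto simp: A_def Z Ttilde_def Ftilde_def)
  moreover have "trivial_mor B Z g" if X: "X \<in> Ttilde" and Y: "Y \<in> Ftilde" and g: "g \<in> Hom B X Y"
    for X Y g
  proof -
    have X: "X \<in> T" "X \<in> ObA" and Y: "Y \<in> Obj B" "FObj R Y \<in> F"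
      using X Y sub by (auto simp: Ttilde_def Ftilde_def)
    \<comment> \<open>The lift runs from \<open>T\<close> to \<open>F\<close> inside
      \<open>A\<close>, so the given theory makes it trivial; composing with the counit recovers
      \<open>g\<close>.\<close>
    obtain g' where g': "g' \<in> Hom B X (FObj R Y)" "g = c Y \<cdot>\<^bsub>B\<^esub> g'" using counit_lift[OF g X(2)] .
    have "trivial_mor A Z g'"
      using triv[OF X(1) Y(2)] g'(1) X R_obj[OF Y(1)] by (simp add: A_def Hom_full_subcat)
    then have "trivial_mor B Z g'"
      using trivial_mor_full_subcat_iff[OF g'(1) X(2) R_obj[OF Y(1)] ZA] by (simp add: A_def)
    then show ?thesis using trivial_mor_comp_left[OF g'(1) counit_hom[OF Y(1)]] g'(2) by simp
  qed
  moreover have "\<exists>TX\<in>Ttilde. \<exists>FX\<in>Ftilde. \<exists>k\<in>Hom B TX X. \<exists>r\<in>Hom B X FX. short_Zexact B Z k r"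
    if X: "X \<in> Obj B" for X
  proof -
    note RX = TF[OF R_obj[OF X]]
    obtain FX \<rho> \<omega> where FX: "FX \<in> Obj B" and \<rho>: "\<rho> \<in> Hom B X FX"
      and \<omega>: "\<omega> \<in> Hom A (FObj R FX) (FObj f (FObj R X))" "isomorphism A \<omega>"
        "\<omega> \<cdot>\<^bsub>A\<^esub> FArr R \<rho> = r (FObj R X)"
      and cok: "is_Zcokernel B Z \<rho> (\<epsilon> X)"
      using cond2 X by metis
    have kX: "k (FObj R X) \<in> Hom B (FObj t (FObj R X)) (FObj R X)"
      and rX: "r (FObj R X) \<in> Hom B (FObj R X) (FObj f (FObj R X))" using RX(3,4) HA by blast+
    \<comment> \<open>\<open>\<omega>\<close> is an isomorphism from \<open>FObj R FX\<close> to an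
      object of \<open>F\<close>, and \<open>F\<close> is replete in \<open>A\<close>.\<close>
    have "FX \<in> Ftilde"
      using FX replete_iso_iff[OF ft(2) \<omega>(1,2)] RX(2) by (simp add: Ftilde_def)
    moreover have "\<epsilon> X \<in> Hom B (FObj t (FObj R X)) X"
      using comp_hom[OF kX counit_hom[OF X]] by (simp add: \<epsilon>_def)
    moreover have "is_Zkernel B Z (\<epsilon> X) \<rho>"
      unfolding \<epsilon>_def
    proof (rule is_Zkernel_counit_comp[OF ZA _ \<rho> kX])
      show "Y \<in> ObA" if W: "W \<in> Z" and ne: "Hom B Y W \<noteq> {}" for Y W
      proof -
        have "Y \<in> Obj B" using ne Hom_obj(1) by blast
        then show ?thesis using cond1 W ne by (auto simp: A_def)
      qed
      \<comment> \<open>The kernel and cokernel conditions share the triviality of this composite,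
        so condition (2) supplies it.\<close>
      show "trivial_mor B Z (\<rho> \<cdot>\<^bsub>B\<^esub> (c X \<cdot>\<^bsub>B\<^esub> k (FObj R X)))"
        using cok by (simp add: is_Zcokernel_def \<epsilon>_def)
      show "\<omega> \<in> Hom B (FObj R FX) (FObj f (FObj R X))" "\<omega> \<cdot>\<^bsub>B\<^esub> FArr R \<rho> = r (FObj R X)"
        using \<omega>(1,3) HA by (auto simp: A_def)
    qed (use RX rX sub in \<open>auto simp: A_def\<close>)
    ultimately show ?thesis using RX(1) \<rho> cok unfolding short_Zexact_def Ttilde_def by blast
  qed
  ultimately show ?thesis by (simp add: pretorsion_theory_def)
qed

end
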